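(* Let $X,Y$ be finite-dimensional normed spaces over $\mathbb{R}$, and let $\Phi, \Psi$ be linear flows on $X,Y$, respectively. Then each of the following four statements implies the other three: (i) $\Phi, \Psi$ are $C^1$-orbit equivalent; (ii) $\Phi, \Psi$ are $C^1$-flow equivalent; (iii) $\Phi, \Psi$ are linearly flow equivalent; (iv) $A^{\Phi}, \alpha A^{\Psi}$ are similar for some $\alpha\in\mathbb{R}^+$.
   Context: $\mathbb{R}^+$ denotes the set of positive real numbers. A flow on $X$ is a continuous map $\varphi:\mathbb{R}\times X\to X$ with $\varphi(t,\varphi(s,x))=\varphi(t+s,x)$ and $\varphi(0,x)=x$ for all $t,s\in\mathbb{R}$, $x\in X$; write $\varphi_t=\varphi(t,\cdot)$. A flow $\Phi$ is linear if every $\Phi_t$ is linear, equivalently $\Phi_t=e^{tA^{\Phi}}$ for all $t\in\mathbb{R}$, with a unique linear operator $A^{\Phi}:X\to X$, called the generator of $\Phi$. Flows $\varphi,\psi$ on $X,Y$ are $C^1$-orbit equivalent if there exist a $C^1$-diffeomorphism $h:X\to Y$ and a function $\tau:\mathbb{R}\times X\to\mathbb{R}$, with $\tau(\cdot,x)$ strictly increasing for each $x\in X$ (no other regularity of $\tau$ is assumed), such that $h(\varphi(t,x))=\psi(\tau(t,x),h(x))$ for all $(t,x)\in\mathbb{R}\times X$. They are $C^1$-flow equivalent if moreover one can choose $\tau(t,x)=\alpha t$ for all $(t,x)$ with some constant $\alpha\in\mathbb{R}^+$. They are linearly flow equivalent if this holds with $\tau(t,x)=\alpha t$ and $h$ a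 linear isomorphism. Linear operators $A:X\to X$ and $B:Y\to Y$ are similar if $HA=BH$ for some linear isomorphism $H:X\to Y$. *)

theory Defs
  imports "HOL-Analysis.Analysis"
begin

definition finite_dim :: "'a::real_normed_vector itself \<Rightarrow> bool" where
  "finite_dim _ \<longleftrightarrow> (\<exists>B :: 'a set. finite B \<and> span B = UNIV)"

definition flow :: "(real \<Rightarrow> 'a::real_normed_vector \<Rightarrow> 'a) \<Rightarrow> bool" where
  "flow \<phi> \<longleftrightarrow>
     continuous_on UNIV (\<lambda>(t, x). \<phi> t x) \<and>
     (\<forall>t s x. \<phi> t (\<phi> s x) = \<phi> (t + s) x) \<and>
     (\<forall>x. \<phi> 0 x = x)"

definition linear_flow :: "(real \<Rightarrow> 'a::real_normed_vector \<Rightarrow> 'a) \<Rightarrow> bool" where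
  "linear_flow \<Phi> \<longleftrightarrow> flow \<Phi> \<and> (\<forall>t. linear (\<Phi> t))"

text \<open>The library has no exponential of linear operators (\<^const>\<open>exp\<close> lives in a type class that
  endomorphisms do not instantiate), so we use the power series. In finite dimension it makes no
  difference whether it is summed pointwise, as here, or in the operator norm.\<close>

definition op_exp :: "('a::real_normed_vector \<Rightarrow> 'a) \<Rightarrow> 'a \<Rightarrow> 'a" where
  "op_exp A x = (\<Sum>n. (A ^^ n) x /\<^sub>R fact n)"

text \<open>For a linear flow on a finite-dimensional space there is exactly one such operator, so the
  description is proper there.\<close>

definition generator :: "(real \<Rightarrow> 'a::real_normed_vector \<Rightarrow> 'a) \<Rightarrow> 'a \<Rightarrow> 'a" where
  "generator \<Phi> = (THE A. linear A \<and> (\<forall>t. \<Phi> t = op_exp (\<lambda>x. t *\<^sub>R A x)))"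

definition C1 :: "('a::real_normed_vector \<Rightarrow> 'b::real_normed_vector) \<Rightarrow> bool" where
  "C1 h \<longleftrightarrow>
     (\<exists>h' :: 'a \<Rightarrow> 'a \<Rightarrow>\<^sub>L 'b.
        (\<forall>x. (h has_derivative blinfun_apply (h' x)) (at x)) \<and> continuous_on UNIV h')"

definition C1_diffeomorphism :: "('a::real_normed_vector \<Rightarrow> 'b::real_normed_vector) \<Rightarrow> bool" where
  "C1_diffeomorphism h \<longleftrightarrow> bij h \<and> C1 h \<and> C1 (inv h)"

definition linear_isomorphism :: "('a::real_normed_vector \<Rightarrow> 'b::real_normed_vector) \<Rightarrow> bool" where
  "linear_isomorphism H \<longleftrightarrow> linear H \<and> bij H"

definition C1_orbit_equivalent ::
  "(real \<Rightarrow> 'a::real_normed_vector \<Rightarrow> 'a) \<Rightarrow> (real \<Rightarrow> 'b::real_normed_vector \<Rightarrow> 'b) \<Rightarrow> bool" where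
  "C1_orbit_equivalent \<phi> \<psi> \<longleftrightarrow>
     (\<exists>(h :: 'a \<Rightarrow> 'b) (\<tau> :: real \<Rightarrow> 'a \<Rightarrow> real).
        C1_diffeomorphism h \<and>
        (\<forall>x. strict_mono (\<lambda>t. \<tau> t x)) \<and>
        (\<forall>t x. h (\<phi> t x) = \<psi> (\<tau> t x) (h x)))"

definition C1_flow_equivalent ::
  "(real \<Rightarrow> 'a::real_normed_vector \<Rightarrow> 'a) \<Rightarrow> (real \<Rightarrow> 'b::real_normed_vector \<Rightarrow> 'b) \<Rightarrow> bool" where
  "C1_flow_equivalent \<phi> \<psi> \<longleftrightarrow>
     (\<exists>(h :: 'a \<Rightarrow> 'b) (\<alpha> :: real).
        C1_diffeomorphism h \<and> \<alpha> > 0 \<and>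
        (\<forall>t x. h (\<phi> t x) = \<psi> (\<alpha> * t) (h x)))"

definition linearly_flow_equivalent ::
  "(real \<Rightarrow> 'a::real_normed_vector \<Rightarrow> 'a) \<Rightarrow> (real \<Rightarrow> 'b::real_normed_vector \<Rightarrow> 'b) \<Rightarrow> bool" where
  "linearly_flow_equivalent \<phi> \<psi> \<longleftrightarrow>
     (\<exists>(h :: 'a \<Rightarrow> 'b) (\<alpha> :: real).
        linear_isomorphism h \<and> \<alpha> > 0 \<and>
        (\<forall>t x. h (\<phi> t x) = \<psi> (\<alpha> * t) (h x)))"

definition similar_ops ::
  "('a::real_normed_vector \<Rightarrow> 'a) \<Rightarrow> ('b::real_normed_vector \<Rightarrow> 'b) \<Rightarrow> bool" where
  "similar_ops A B \<longleftrightarrow> (\<exists>H :: 'a \<Rightarrow> 'b. linear_isomorphism H \<and> H \<circ> A = B \<circ> H)"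

end

theory Submission
  imports Defs
begin

text \<open>Write \<open>A\<close> and \<open>B\<close> for the generators of \<open>\<Phi>\<close> and \<open>\<Psi>\<close>. The implications from similarity to linear flow
  equivalence, on to \<open>C\<^sup>1\<close>-flow equivalence and to \<open>C\<^sup>1\<close>-orbit equivalence are routine: a linear
  isomorphism that intertwines the generators intertwines the exponential series, and linear maps
  between finite-dimensional spaces are smooth. All of the content lies in
  \<open>orbit_equivalent_imp_similar\<close>, which shows that the derivative \<open>H\<close> of the orbit equivalence \<open>h\<close>
  at the origin already makes \<open>A\<close> similar to a positive multiple of \<open>B\<close>.

  The difficulty is that nothing is known about \<open>\<tau>\<close> except that it increases in time. Along an orbit,
  the \<open>C\<^sup>1\<close> curve \<open>h (\<Phi> t x)\<close> runs through the smooth curve \<open>\<Psi> s (h x)\<close> in the order of time. At a time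
  where \<open>\<tau>\<close> is continuous, the difference quotients of the two parametrizations are positive multiples
  of each other, so their limits \<open>h' (\<Phi> t x) (A (\<Phi> t x))\<close> and \<open>B (h (\<Phi> t x))\<close> do not point in
  different directions. This relation is written \<open>codirectional u v\<close>, and it is encoded by the equation
  \<open>norm v *\<^sub>R u = norm u *\<^sub>R v\<close> because an equation between continuous functions survives limits. As a
  monotone function has only countably many discontinuities, the relation holds at all times, in
  particular at time zero: \<open>h' x (A x)\<close> and \<open>B (h x)\<close> are codirectional for every \<open>x\<close>. Zooming in on the
  origin, that is, replacing \<open>x\<close> by \<open>r *\<^sub>R x\<close>, dividing by \<open>r\<close> and letting \<open>r\<close> tend to zero from above,
  shows that \<open>H (A x)\<close> and \<open>B (H x)\<close> are codirectional for every \<open>x\<close>. These two linear maps have the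
  same kernel, because \<open>h\<close> maps the fixed points of \<open>\<Phi>\<close> onto those of \<open>\<Psi>\<close>, and two linear maps that
  have the same kernel and are codirectional at every point differ by a positive factor.

  Before this can be said, linear flows need generators. Coordinates are continuous in a
  finite-dimensional normed space, so all linear maps are bounded and all subspaces are closed; the
  vectors whose trajectory is differentiable at time zero form a subspace that is dense, hence
  everything; and Taylor expansion of each coordinate gives the exponential series.\<close>

section \<open>Finite-dimensional normed spaces\<close>

text \<open>A bound on the coefficients turns a Cauchy sequence of linear combinations into Cauchy sequences of
  coefficients; the limits of the latter are the coefficients of the limit.\<close>

lemma closed_span_if_coefficients_bounded:
  fixes S :: "'a::real_normed_vector set"
  assumes fin: "finite S"
    and bound: "\<And>u b. b \<in> S \<Longrightarrow> \<bar>u b\<bar> \<le> C * norm (\<Sum>b\<in>S. u b *\<^sub>R b)"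
  shows "closed (span S)"
  unfolding closed_sequential_limits
proof (intro allI impI, elim conjE)
  fix y l assume y: "\<forall>n. y n \<in> span S" and lim: "y \<longlonglongrightarrow> l"
  have "\<forall>n. \<exists>u. y n = (\<Sum>b\<in>S. u b *\<^sub>R b)"
    using y unfolding span_finite[OF fin] by auto
  then obtain u where u: "\<And>n. y n = (\<Sum>b\<in>S. u n b *\<^sub>R b)" by metis
  have diff: "\<bar>u m b - u n b\<bar> \<le> C * norm (y m - y n)" if "b \<in> S" for m n b
    using bound[OF that, of "\<lambda>b. u m b - u n b"]
    by (simp add: u scaleR_left_diff_distrib sum_subtractf)
  have "convergent (\<lambda>n. u n b)" if b: "b \<in> S" for b
  proof (rule Cauchy_convergent, rule CauchyI)
    fix e :: real assume e: "e > 0"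
    define e' where "e' = e / (\<bar>C\<bar> + 1)"
    have e': "e' > 0" using e by (simp add: e'_def)
    obtain M where M: "\<And>m n. m \<ge> M \<Longrightarrow> n \<ge> M \<Longrightarrow> norm (y m - y n) < e'"
      using CauchyD[OF LIMSEQ_imp_Cauchy[OF lim] e'] by blast
    have "norm (u m b - u n b) < e" if "m \<ge> M" "n \<ge> M" for m n
    proof -
      have "\<bar>u m b - u n b\<bar> \<le> (\<bar>C\<bar> + 1) * norm (y m - y n)"
        using diff[OF b, of m n] by (rule order_trans) (simp add: mult_right_mono)
      also have "\<dots> < (\<bar>C\<bar> + 1) * e'" using M[OF that] by (intro mult_strict_left_mono) auto
      also have "\<dots> = e" by (simp add: e'_def)
      finally show ?thesis by simp
    qed
    then show "\<exists>M. \<forall>m\<ge>M. \<forall>n\<ge>M. norm (u m b - u n b) < e" by blast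
  qed
  then have "\<forall>b\<in>S. \<exists>v. (\<lambda>n. u n b) \<longlonglongrightarrow> v" by (simp add: convergent_def)
  then obtain v where v: "\<And>b. b \<in> S \<Longrightarrow> (\<lambda>n. u n b) \<longlonglongrightarrow> v b" by metis
  have "y \<longlonglongrightarrow> (\<Sum>b\<in>S. v b *\<^sub>R b)"
    unfolding u by (intro tendsto_sum tendsto_scaleR v tendsto_const)
  then have "l = (\<Sum>b\<in>S. v b *\<^sub>R b)" using lim LIMSEQ_unique by blast
  then show "l \<in> span S" by (simp add: span_sum span_scale span_base)
qed

text \<open>Induction on the independent set. A new vector \<open>a\<close> lies outside the span of the old ones, which is
  closed by the induction hypothesis, so \<open>a\<close> keeps a distance \<open>e > 0\<close> from it. This bounds
  the coefficient of \<open>a\<close> by \<open>1 / e\<close> times the norm of the combination, and subtracting the term with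
  \<open>a\<close> reduces the other coefficients to the induction hypothesis.\<close>

lemma independent_coefficients_bounded:
  fixes S :: "'a::real_normed_vector set"
  assumes "finite S" "independent S"
  shows "\<exists>C. \<forall>u. \<forall>b\<in>S. \<bar>u b\<bar> \<le> C * norm (\<Sum>b\<in>S. u b *\<^sub>R b)"
  using assms
proof (induction S rule: finite_induct)
  case empty
  then show ?case by simp
next
  case (insert a S)
  have ind: "independent S" and a: "a \<notin> span S"
    using insert.prems insert.hyps independent_insert by metis+
  obtain C where C: "\<And>u b. b \<in> S \<Longrightarrow> \<bar>u b\<bar> \<le> C * norm (\<Sum>b\<in>S. u b *\<^sub>R b)"
    using insert.IH[OF ind] by blast
  have "closed (span S)"
    using closed_span_if_coefficients_bounded[OF insert.hyps(1) C] .
  then have "open (- span S)" by (rule open_Compl)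
  then obtain e where e: "e > 0" "\<And>y. dist y a < e \<Longrightarrow> y \<notin> span S"
    using a unfolding open_dist by (metis ComplI Compl_iff)
  have ua: "\<bar>u a\<bar> \<le> (1 / e) * norm (\<Sum>b\<in>insert a S. u b *\<^sub>R b)" for u
  proof (cases "u a = 0")
    case True
    then show ?thesis using e(1) by simp
  next
    case False
    define w where "w = (\<Sum>b\<in>S. u b *\<^sub>R b)"
    have "w \<in> span S" by (simp add: w_def span_sum span_scale span_base)
    then have "(- 1 / u a) *\<^sub>R w \<in> span S" by (rule span_scale)
    then have "e \<le> dist ((- 1 / u a) *\<^sub>R w) a" using e(2) by force
    also have "dist ((- 1 / u a) *\<^sub>R w) a = norm ((- 1 / u a) *\<^sub>R (u a *\<^sub>R a + w))"
      using False
      by (simp add: dist_norm scaleR_add_right) (rule arg_cong[OF minus_diff_commute])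
    also have "\<dots> = norm (u a *\<^sub>R a + w) / \<bar>u a\<bar>" by simp
    finally have "e * \<bar>u a\<bar> \<le> norm (u a *\<^sub>R a + w)" using False by (simp add: field_simps)
    moreover have "(\<Sum>b\<in>insert a S. u b *\<^sub>R b) = u a *\<^sub>R a + w"
      using insert.hyps by (simp add: w_def)
    ultimately show ?thesis using e(1) by (simp add: field_simps)
  qed
  define D where "D = \<bar>C\<bar> * (1 + norm a / e) + 1 / e"
  have D: "\<bar>u b\<bar> \<le> D * norm (\<Sum>b\<in>insert a S. u b *\<^sub>R b)" if b: "b \<in> insert a S" for u b
  proof -
    let ?x = "\<Sum>b\<in>insert a S. u b *\<^sub>R b" and ?w = "\<Sum>b\<in>S. u b *\<^sub>R b"
    have x: "?x = u a *\<^sub>R a + ?w" using insert.hyps by simp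
    show ?thesis
    proof (cases "b = a")
      case True
      have "1 / e \<le> D" using e(1) by (simp add: D_def)
      then show ?thesis using ua[of u] True by (meson mult_right_mono norm_ge_zero order_trans)
    next
      case False
      have "norm ?w = norm (?x - u a *\<^sub>R a)" using x by simp
      also have "\<dots> \<le> norm ?x + \<bar>u a\<bar> * norm a"
        using norm_triangle_ineq4[of ?x "u a *\<^sub>R a"] by simp
      also have "\<dots> \<le> norm ?x + ((1 / e) * norm ?x) * norm a"
        using ua[of u] by (simp add: mult_right_mono del: times_divide_eq_left)
      also have "\<dots> = (1 + norm a / e) * norm ?x" by (simp add: algebra_simps)
      finally have w: "norm ?w \<le> (1 + norm a / e) * norm ?x" .
      have "\<bar>u b\<bar> \<le> C * norm ?w" using C[of b u] b False by simp
      also have "\<dots> \<le> \<bar>C\<bar> * norm ?w" by (simp add: mult_right_mono)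
      also have "\<dots> \<le> \<bar>C\<bar> * ((1 + norm a / e) * norm ?x)" using w by (simp add: mult_left_mono)
      also have "\<dots> \<le> D * norm ?x" using e(1) by (simp add: D_def algebra_simps)
      finally show ?thesis .
    qed
  qed
  then show ?case by blast
qed

lemma finite_dim_finite_basis:
  fixes V :: "'a::real_normed_vector set"
  assumes "finite_dim TYPE('a)"
  obtains B where "finite B" "independent B" "B \<subseteq> V" "V \<subseteq> span B"
proof -
  obtain T :: "'a set" where T: "finite T" "span T = UNIV"
    using assms by (auto simp: finite_dim_def)
  obtain B where B: "B \<subseteq> V" "independent B" "V \<subseteq> span B"
    using maximal_independent_subset[of V] by blast
  then have "finite B" using independent_span_bound[OF T(1)] T(2) by auto
  with B show thesis using that by blast
qed

lemma finite_dim_closed_subspace: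
  fixes V :: "'a::real_normed_vector set"
  assumes "finite_dim TYPE('a)" "subspace V"
  shows "closed V"
proof -
  obtain B where B: "finite B" "independent B" "B \<subseteq> V" "V \<subseteq> span B"
    using finite_dim_finite_basis[OF assms(1)] .
  then have "V = span B" using assms(2) span_minimal[of B V] by auto
  moreover obtain C where "\<And>u b. b \<in> B \<Longrightarrow> \<bar>u b\<bar> \<le> C * norm (\<Sum>b\<in>B. u b *\<^sub>R b)"
    using independent_coefficients_bounded[OF B(1,2)] by blast
  ultimately show ?thesis using closed_span_if_coefficients_bounded[OF B(1)] by metis
qed

text \<open>The families \<open>B\<close> and \<open>c\<close> replace an isomorphism with a Euclidean space: the dimension
  is not tied to an index type here, and continuous coordinates are all that the later proofs use.\<close>

lemma finite_dim_coordinates: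
  assumes "finite_dim TYPE('a::real_normed_vector)"
  obtains B :: "'a::real_normed_vector set" and c :: "'a \<Rightarrow> 'a \<Rightarrow> real"
  where "finite B" "\<forall>b\<in>B. bounded_linear (c b)" "\<forall>x. (\<Sum>b\<in>B. c b x *\<^sub>R b) = x"
proof -
  obtain B :: "'a set" where B: "finite B" "independent B" "B \<subseteq> UNIV" "UNIV \<subseteq> span B"
    using finite_dim_finite_basis[OF assms] .
  obtain C where C: "\<And>u b. b \<in> B \<Longrightarrow> \<bar>u b\<bar> \<le> C * norm (\<Sum>b\<in>B. u b *\<^sub>R b)"
    using independent_coefficients_bounded[OF B(1,2)] by blast
  let ?c = "\<lambda>b x. representation B x b"
  have rep: "(\<Sum>b\<in>B. ?c b x *\<^sub>R b) = x" for x
    using real_vector.sum_representation_eq[of B x B] B by auto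
  have bl: "bounded_linear (?c b)" if "b \<in> B" for b
  proof (rule bounded_linear_intro[where K = C])
    fix x y and r :: real
    show "?c b (x + y) = ?c b x + ?c b y"
      using B by (subst real_vector.representation_add) auto
    show "?c b (r *\<^sub>R x) = r *\<^sub>R ?c b x"
      using B by (subst real_vector.representation_scale) auto
    show "norm (?c b x) \<le> norm x * C"
      using C[OF that, of "representation B x"] rep[of x] by (simp add: mult.commute)
  qed
  show thesis
  proof (rule that)
    show "finite B" by (rule B(1))
    show "\<forall>b\<in>B. bounded_linear (?c b)" by (intro ballI bl)
    show "\<forall>x. (\<Sum>b\<in>B. ?c b x *\<^sub>R b) = x" by (intro allI rep)
  qed
qed

lemma finite_dim_linear_bounded:
  fixes f :: "'a::real_normed_vector \<Rightarrow> 'b::real_normed_vector"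
  assumes "finite_dim TYPE('a)" "linear f"
  shows "bounded_linear f"
proof -
  obtain B :: "'a set" and c where B: "finite B" "\<forall>b\<in>B. bounded_linear (c b)"
    and rep: "\<forall>x. (\<Sum>b\<in>B. c b x *\<^sub>R b) = x"
    using finite_dim_coordinates[OF assms(1)] .
  define g where "g x = (\<Sum>b\<in>B. c b x *\<^sub>R f b)" for x
  have "f x = g x" for x
  proof -
    have "f x = f (\<Sum>b\<in>B. c b x *\<^sub>R b)" using rep by simp
    then show ?thesis by (simp add: g_def linear_sum[OF assms(2)] linear_scale[OF assms(2)])
  qed
  then have "f = g" by blast
  moreover have "bounded_linear g"
    unfolding g_def
    by (intro bounded_linear_sum bounded_linear_compose[OF bounded_linear_scaleR_left] B(2)[rule_format])
  ultimately show ?thesis by simp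
qed

section \<open>Codirectional vectors\<close>

text \<open>For nonzero vectors this says that one is a positive multiple of the other; the zero vector is
  codirectional to everything. Stated as an equation, the relation is closed, whereas being a
  positive multiple is not.\<close>

definition codirectional :: "'a::real_normed_vector \<Rightarrow> 'a \<Rightarrow> bool" where
  "codirectional u v \<longleftrightarrow> norm v *\<^sub>R u = norm u *\<^sub>R v"

lemma codirectional_scaleR:
  assumes "r > 0" "s > 0"
  shows "codirectional (r *\<^sub>R u) (s *\<^sub>R v) \<longleftrightarrow> codirectional u v"
proof -
  have eq: "norm (s *\<^sub>R v) *\<^sub>R (r *\<^sub>R u) = (r * s) *\<^sub>R (norm v *\<^sub>R u)"
    "norm (r *\<^sub>R u) *\<^sub>R (s *\<^sub>R v) = (r * s) *\<^sub>R (norm u *\<^sub>R v)"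
    using assms by (simp_all add: mult_ac)
  have "r * s \<noteq> 0" using assms by simp
  then show ?thesis unfolding codirectional_def eq by (simp only: scaleR_cancel_left simp_thms)
qed

lemma codirectional_tendsto:
  assumes "F \<noteq> bot" "(u \<longlongrightarrow> a) F" "(v \<longlongrightarrow> b) F" "\<forall>\<^sub>F t in F. codirectional (u t) (v t)"
  shows "codirectional a b"
proof -
  have 1: "((\<lambda>t. norm (v t) *\<^sub>R u t) \<longlongrightarrow> norm b *\<^sub>R a) F"
    and 2: "((\<lambda>t. norm (u t) *\<^sub>R v t) \<longlongrightarrow> norm a *\<^sub>R b) F"
    using assms(2,3) by (auto intro!: tendsto_intros)
  have "((\<lambda>t. norm (v t) *\<^sub>R u t) \<longlongrightarrow> norm a *\<^sub>R b) F"
    using assms(4) unfolding codirectional_def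
    by (rule Lim_transform_eventually[OF 2 eventually_mono]) (rule sym)
  then show ?thesis
    using tendsto_unique[OF assms(1) 1] by (simp add: codirectional_def)
qed

text \<open>If \<open>Q x\<close> and \<open>Q z\<close> are independent, evaluating at \<open>x + z\<close> forces the two factors to agree. If
  \<open>Q x = k *\<^sub>R Q z\<close>, then \<open>x - k *\<^sub>R z\<close> is in the common kernel. The second case also covers a map \<open>Q\<close> of
  rank one, where the first argument says nothing. Equality of the kernels makes the factor
  positive.\<close>

lemma codirectional_linear_maps_proportional:
  fixes P Q :: "'a::real_vector \<Rightarrow> 'b::real_normed_vector"
  assumes P: "linear P" and Q: "linear Q"
    and co: "\<And>x. codirectional (P x) (Q x)"
    and ker: "\<And>x. P x = 0 \<longleftrightarrow> Q x = 0"
  shows "\<exists>\<alpha>>0. \<forall>x. P x = \<alpha> *\<^sub>R Q x"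
proof (cases "\<forall>x. Q x = 0")
  case True
  then show ?thesis using ker by (intro exI[of _ 1]) auto
next
  case False
  have mu: "\<exists>\<mu>>0. P x = \<mu> *\<^sub>R Q x" if "Q x \<noteq> 0" for x
  proof -
    have "P x \<noteq> 0" using ker that by blast
    have "P x = (1 / norm (Q x)) *\<^sub>R (norm (Q x) *\<^sub>R P x)" using that by simp
    also have "\<dots> = (norm (P x) / norm (Q x)) *\<^sub>R Q x"
      using co[of x] by (simp add: codirectional_def)
    finally show ?thesis using that \<open>P x \<noteq> 0\<close> by (intro exI[of _ "norm (P x) / norm (Q x)"]) simp
  qed
  obtain z where z: "Q z \<noteq> 0" using False by blast
  obtain \<alpha> where \<alpha>: "\<alpha> > 0" "P z = \<alpha> *\<^sub>R Q z" using mu[OF z] by blast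
  have "P x = \<alpha> *\<^sub>R Q x" for x
  proof (cases "\<exists>k. Q x = k *\<^sub>R Q z")
    case True
    then obtain k where k: "Q x = k *\<^sub>R Q z" by blast
    then have "Q (x - k *\<^sub>R z) = 0" by (simp add: linear_diff[OF Q] linear_scale[OF Q])
    then have "P (x - k *\<^sub>R z) = 0" using ker by blast
    then show ?thesis
      using k \<alpha>(2) by (simp add: linear_diff[OF P] linear_scale[OF P])
  next
    case False
    have "Q x \<noteq> 0" using False[simplified, rule_format, of 0] by simp
    then obtain \<mu> where \<mu>: "P x = \<mu> *\<^sub>R Q x" using mu by blast
    have "Q (x + z) \<noteq> 0"
      using False[simplified, rule_format, of "-1"] by (simp add: linear_add[OF Q] add_eq_0_iff2)
    then obtain \<nu> where \<nu>: "P (x + z) = \<nu> *\<^sub>R Q (x + z)" using mu by blast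
    have eq: "(\<mu> - \<nu>) *\<^sub>R Q x = (\<nu> - \<alpha>) *\<^sub>R Q z"
      using \<nu> \<mu> \<alpha>(2) by (simp add: linear_add[OF P] linear_add[OF Q] algebra_simps)
    have "\<mu> = \<nu>"
    proof (rule ccontr)
      assume ne: "\<mu> \<noteq> \<nu>"
      have "Q x = (1 / (\<mu> - \<nu>)) *\<^sub>R ((\<mu> - \<nu>) *\<^sub>R Q x)" using ne by simp
      also have "\<dots> = ((\<nu> - \<alpha>) / (\<mu> - \<nu>)) *\<^sub>R Q z" unfolding eq by simp
      finally show False using False by blast
    qed
    with eq z have "\<alpha> = \<mu>" by simp
    with \<mu> show ?thesis by simp
  qed
  with \<alpha>(1) show ?thesis by blast
qed

text \<open>The quotient is written with a scalar factor in front of the increment, so that two quotients with the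
  same increment and different time steps are visibly multiples of each other.\<close>

lemma has_vector_derivative_at_iff_quotient:
  "(f has_vector_derivative D) (at x within S) \<longleftrightarrow>
     ((\<lambda>y. (1 / (y - x)) *\<^sub>R (f y - f x)) \<longlongrightarrow> D) (at x within S)"
proof -
  have eq: "norm ((1 / norm (y - x)) *\<^sub>R (f y - (f x + (y - x) *\<^sub>R D)))
      = norm ((1 / (y - x)) *\<^sub>R (f y - f x) - D)" if "y \<noteq> x" for y
  proof -
    have "(1 / (y - x)) *\<^sub>R (f y - f x) - D = (1 / (y - x)) *\<^sub>R (f y - (f x + (y - x) *\<^sub>R D))"
      using that by (simp add: scaleR_diff_right scaleR_add_right)
    then show ?thesis by simp
  qed
  have "(f has_vector_derivative D) (at x within S) \<longleftrightarrow>
     ((\<lambda>y. norm ((1 / norm (y - x)) *\<^sub>R (f y - (f x + (y - x) *\<^sub>R D)))) \<longlongrightarrow> 0) (at x within S)"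
    by (simp only: has_vector_derivative_def has_derivative_within tendsto_norm_zero_iff
        bounded_linear_scaleR_left simp_thms)
  also have "\<dots> \<longleftrightarrow> ((\<lambda>y. norm ((1 / (y - x)) *\<^sub>R (f y - f x) - D)) \<longlongrightarrow> 0) (at x within S)"
    by (rule filterlim_cong[OF refl refl]) (use eq in \<open>auto simp: eventually_at_filter\<close>)
  also have "\<dots> \<longleftrightarrow> ((\<lambda>y. (1 / (y - x)) *\<^sub>R (f y - f x)) \<longlongrightarrow> D) (at x within S)"
    by (simp only: tendsto_norm_zero_iff LIM_zero_iff)
  finally show ?thesis .
qed

text \<open>Continuity at the single time \<open>t0\<close> is enough to substitute \<open>s t\<close> for the time of \<open>\<gamma>\<close> in the difference
  quotient. Strict monotonicity keeps the denominator different from zero.\<close>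

lemma quotient_along_reparametrization:
  fixes \<gamma> :: "real \<Rightarrow> 'b::real_normed_vector" and s :: "real \<Rightarrow> real"
  assumes "(\<gamma> has_vector_derivative D) (at (s t0))" "strict_mono s" "isCont s t0"
  shows "((\<lambda>t. (1 / (s t - s t0)) *\<^sub>R (\<gamma> (s t) - \<gamma> (s t0))) \<longlongrightarrow> D) (at t0)"
proof -
  have s_lim: "filterlim s (at (s t0)) (at t0)"
    unfolding filterlim_at
  proof
    show "\<forall>\<^sub>F x in at t0. s x \<in> UNIV \<and> s x \<noteq> s t0"
      using assms(2) by (auto simp: eventually_at_filter strict_mono_eq)
    show "(s \<longlongrightarrow> s t0) (at t0)" using assms(3) by (simp add: isCont_def)
  qed
  have "((\<lambda>r. (1 / (r - s t0)) *\<^sub>R (\<gamma> r - \<gamma> (s t0))) \<longlongrightarrow> D) (at (s t0))"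
    using assms(1) by (simp add: has_vector_derivative_at_iff_quotient)
  from filterlim_compose[OF this s_lim] show ?thesis .
qed

text \<open>The claim is a closed condition on \<open>t\<close>. Where \<open>s\<close> is continuous, it holds since the difference quotients
  of \<open>c\<close> with respect to \<open>t\<close> and to \<open>s t\<close> differ by a positive factor; and the complement of a countable
  set is dense in the line. The hypothesis that \<open>\<gamma>' (s t)\<close> is continuous in \<open>t\<close> can hold although
  \<open>s\<close> jumps: for a flow, \<open>\<gamma>'\<close> is a continuous function of the position \<open>\<gamma> (s t) = c t\<close>.\<close>

lemma codirectional_monotone_reparametrization:
  fixes c \<gamma> :: "real \<Rightarrow> 'b::real_normed_vector" and s :: "real \<Rightarrow> real"
  assumes c: "\<And>t. (c has_vector_derivative c' t) (at t)"
    and \<gamma>: "\<And>t. (\<gamma> has_vector_derivative \<gamma>' t) (at t)"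
    and s: "strict_mono s"
    and eq: "\<And>t. c t = \<gamma> (s t)"
    and cont: "continuous_on UNIV c'" "continuous_on UNIV (\<lambda>t. \<gamma>' (s t))"
  shows "codirectional (c' t) (\<gamma>' (s t))"
proof -
  define S where "S = {t. codirectional (c' t) (\<gamma>' (s t))}"
  have "closed S"
    unfolding S_def codirectional_def
    by (intro closed_Collect_eq continuous_intros cont)
  have good: "t0 \<in> S" if "isCont s t0" for t0
  proof -
    let ?u = "\<lambda>t. (1 / (t - t0)) *\<^sub>R (c t - c t0)"
    let ?v = "\<lambda>t. (1 / (s t - s t0)) *\<^sub>R (c t - c t0)"
    have u: "(?u \<longlongrightarrow> c' t0) (at t0)"
      using c[of t0] by (simp add: has_vector_derivative_at_iff_quotient)
    have v: "(?v \<longlongrightarrow> \<gamma>' (s t0)) (at t0)"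
      unfolding eq by (rule quotient_along_reparametrization[OF \<gamma> s that])
    have "codirectional (?u t) (?v t)" if "t \<noteq> t0" for t
    proof -
      define r where "r = (s t - s t0) / (t - t0)"
      have "r > 0"
        using s that unfolding r_def by (cases t t0 rule: linorder_cases)
          (auto simp: strict_mono_less zero_less_divide_iff)
      moreover have "?u t = r *\<^sub>R ?v t"
        using that s by (simp add: r_def strict_mono_eq)
      ultimately show ?thesis
        using codirectional_scaleR[of r 1 "?v t" "?v t"]
        by (simp del: scaleR_scaleR add: codirectional_def)
    qed
    then have "\<forall>\<^sub>F t in at t0. codirectional (?u t) (?v t)"
      by (simp add: eventually_at_filter)
    then show ?thesis
      using codirectional_tendsto[OF _ u v] by (simp add: S_def)
  qed
  have "- S = {}"
  proof (rule ccontr)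
    assume "- S \<noteq> {}"
    moreover have "open (- S)" using \<open>closed S\<close> by (rule open_Compl)
    ultimately obtain t0 where "t0 \<in> - S" "isCont s t0"
      using open_minus_countable[OF mono_ctble_discont[OF strict_mono_mono[OF s]], of "- S"] by auto
    then show False using good by blast
  qed
  then show ?thesis by (auto simp: S_def)
qed

section \<open>Linear flows and their generators\<close>

lemma linear_flowD:
  assumes "linear_flow \<Phi>"
  shows "\<Phi> s (\<Phi> t x) = \<Phi> (s + t) x" "\<Phi> 0 x = x" "linear (\<Phi> t)"
    "continuous_on UNIV (\<lambda>t. \<Phi> t x)"
proof -
  have cont: "continuous_on UNIV (\<lambda>(t, x). \<Phi> t x)" and lin: "linear (\<Phi> t)" for t
    using assms by (auto simp: linear_flow_def flow_def)
  show "\<Phi> s (\<Phi> t x) = \<Phi> (s + t) x" "\<Phi> 0 x = x" "linear (\<Phi> t)"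
    using assms by (auto simp: linear_flow_def flow_def)
  show "continuous_on UNIV (\<lambda>t. \<Phi> t x)"
    using continuous_on_compose2[OF cont, of UNIV "\<lambda>t. (t, x)"]
    by (simp add: continuous_on_Pair continuous_on_id)
qed

text \<open>This is the argument of Hille and Yosida, which avoids logarithms of operators. The time averages
  \<open>(1 / d) *\<^sub>R V d x\<close> of a trajectory tend to \<open>x\<close>, and they have a differentiable trajectory themselves,
  because shifting \<open>V d x\<close> in time only moves the limits of the integral. So the vectors with a
  differentiable trajectory are dense, and they form a subspace, which is closed in finite
  dimension.\<close>

lemma linear_flow_differentiable_at_0:
  fixes \<Phi> :: "real \<Rightarrow> 'a::real_normed_vector \<Rightarrow> 'a"
  assumes fd: "finite_dim TYPE('a)" and \<Phi>: "linear_flow \<Phi>"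
  shows "\<exists>y. ((\<lambda>t. \<Phi> t x) has_vector_derivative y) (at 0)"
proof -
  note flow = linear_flowD[OF \<Phi>]
  obtain B :: "'a set" and c where B: "finite B" "\<forall>b\<in>B. bounded_linear (c b)"
    and rep: "\<forall>x. (\<Sum>b\<in>B. c b x *\<^sub>R b) = x"
    using finite_dim_coordinates[OF fd] .
  have c: "bounded_linear (c b)" if "b \<in> B" for b using B(2) that by blast
  define D where "D = {x. \<exists>y. ((\<lambda>t. \<Phi> t x) has_vector_derivative y) (at 0)}"
  have "subspace D"
    unfolding subspace_def
  proof (intro conjI ballI allI)
    show "0 \<in> D" unfolding D_def using linear_0[OF flow(3)] by (auto intro!: exI[of _ 0])
    show "x + y \<in> D" if xy: "x \<in> D" "y \<in> D" for x y
    proof -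
      obtain u v where "((\<lambda>t. \<Phi> t x) has_vector_derivative u) (at 0)"
        "((\<lambda>t. \<Phi> t y) has_vector_derivative v) (at 0)"
        using xy unfolding D_def by blast
      from has_vector_derivative_add[OF this] show ?thesis
        by (auto simp: D_def linear_add[OF flow(3)])
    qed
    show "r *\<^sub>R x \<in> D" if x: "x \<in> D" for x r
    proof -
      obtain u where "((\<lambda>t. \<Phi> t x) has_vector_derivative u) (at 0)"
        using x unfolding D_def by blast
      from bounded_linear.has_vector_derivative[OF bounded_linear_scaleR_right this, of r]
      show ?thesis by (auto simp: D_def linear_scale[OF flow(3)])
    qed
  qed
  then have closed: "closed D" using finite_dim_closed_subspace[OF fd] by blast
  have cont: "continuous_on S (\<lambda>s. c b (\<Phi> s x))" if "b \<in> B" for b x S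
    by (rule continuous_on_subset[OF bounded_linear.continuous_on[OF c[OF that] flow(4)[of x]]]) simp
  \<comment> \<open>The integral of the trajectory over \<open>{0..d}\<close>, taken in coordinates because the
    integral calculus of vector-valued functions asks for a type of class \<open>banach\<close>.\<close>
  define V where "V d x = (\<Sum>b\<in>B. integral {0..d} (\<lambda>s. c b (\<Phi> s x)) *\<^sub>R b)" for d :: real and x
  have commute: "\<Phi> t (V d x) = V d (\<Phi> t x)" for t d x
  proof -
    have cb: "c a (\<Phi> t (V d x)) = integral {0..d} (\<lambda>s. c a (\<Phi> s (\<Phi> t x)))" if a: "a \<in> B" for a
    proof -
      have lin: "linear (\<lambda>y. c a (\<Phi> t y))"
        using linear_compose[OF flow(3) bounded_linear.linear[OF c[OF a]]] by (simp add: o_def)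
      have "c a (\<Phi> s (\<Phi> t x)) = (\<Sum>b\<in>B. c b (\<Phi> s x) * c a (\<Phi> t b))" for s
      proof -
        have "\<Phi> s (\<Phi> t x) = \<Phi> t (\<Phi> s x)" by (simp only: flow(1) add.commute)
        also have "\<Phi> s x = (\<Sum>b\<in>B. c b (\<Phi> s x) *\<^sub>R b)" using rep by metis
        finally have "c a (\<Phi> s (\<Phi> t x)) = c a (\<Phi> t (\<Sum>b\<in>B. c b (\<Phi> s x) *\<^sub>R b))"
          by (rule arg_cong)
        also have "\<dots> = (\<Sum>b\<in>B. c b (\<Phi> s x) * c a (\<Phi> t b))"
          by (simp only: linear_sum[OF lin] linear_scale[OF lin] real_scaleR_def)
        finally show ?thesis .
      qed
      moreover have "((\<lambda>s. \<Sum>b\<in>B. c b (\<Phi> s x) * c a (\<Phi> t b)) has_integral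
          (\<Sum>b\<in>B. integral {0..d} (\<lambda>s. c b (\<Phi> s x)) * c a (\<Phi> t b))) {0..d}"
        by (intro has_integral_sum B(1) has_integral_mult_left integrable_integral
            integrable_continuous_real cont)
      ultimately have "integral {0..d} (\<lambda>s. c a (\<Phi> s (\<Phi> t x)))
          = (\<Sum>b\<in>B. integral {0..d} (\<lambda>s. c b (\<Phi> s x)) * c a (\<Phi> t b))"
        by (simp only: integral_unique)
      also have "\<dots> = c a (\<Phi> t (V d x))"
        by (simp only: V_def linear_sum[OF lin] linear_scale[OF lin] real_scaleR_def)
      finally show ?thesis by simp
    qed
    have "\<Phi> t (V d x) = (\<Sum>b\<in>B. c b (\<Phi> t (V d x)) *\<^sub>R b)" using rep by metis
    also have "\<dots> = V d (\<Phi> t x)" by (simp only: V_def[of d "\<Phi> t x"] cb cong: sum.cong)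
    finally show ?thesis .
  qed
  have in_D: "V d x \<in> D" if d: "d > 0" for d x
  proof -
    have "((\<lambda>t. integral {0..d} (\<lambda>s. c b (\<Phi> s (\<Phi> t x)))) has_real_derivative
        c b (\<Phi> d x) - c b (\<Phi> 0 x)) (at 0)" if b: "b \<in> B" for b
    proof -
      let ?g = "\<lambda>s. c b (\<Phi> s x)"
      \<comment> \<open>The antiderivative starts at \<open>-1\<close> so that \<open>0\<close> is an interior point and the derivative
        below is two-sided.\<close>
      let ?F = "\<lambda>u. integral {- 1..u} ?g"
      have F: "(?F has_real_derivative ?g u) (at u)" if "-1 < u" "u < d + 1" for u
        using integral_has_real_derivative[of "-1" "d+1" ?g u] cont[OF b, of _ x] that
        by (simp add: at_within_Icc_at)
      have "((\<lambda>t. ?F (d + t) - ?F t) has_real_derivative ?g d - ?g 0) (at 0)"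
      proof (rule DERIV_diff)
        show "((\<lambda>t. ?F (d + t)) has_real_derivative ?g d) (at 0)"
          using F[of d] d DERIV_at_within_shift[of ?F "?g d" d 0 UNIV] by simp
        show "(?F has_real_derivative ?g 0) (at 0)" using F[of 0] d by simp
      qed
      moreover have "\<forall>\<^sub>F t in nhds 0. ?F (d + t) - ?F t = integral {0..d} (\<lambda>s. c b (\<Phi> s (\<Phi> t x)))"
      proof -
        have "\<forall>\<^sub>F t in nhds (0::real). -1 < t" using eventually_nhds_in_open[of "{- 1<..}" "0::real"] by simp
        then show ?thesis
        proof (rule eventually_mono)
          fix t :: real assume t: "- 1 < t"
          have "integral {0..d} (\<lambda>s. c b (\<Phi> s (\<Phi> t x))) = integral {0 + t..d + t} ?g"
            using integral_shift_Icc_real[of 0 d ?g t] by (simp add: o_def flow(1) add.commute)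
          moreover have "?F t + integral {t..d + t} ?g = ?F (d + t)"
            using t d by (intro Henstock_Kurzweil_Integration.integral_combine
                integrable_continuous_real cont b) auto
          ultimately show "?F (d + t) - ?F t = integral {0..d} (\<lambda>s. c b (\<Phi> s (\<Phi> t x)))" by simp
        qed
      qed
      ultimately show ?thesis
        by (rule DERIV_cong_ev[OF refl _ refl, THEN iffD1, rotated])
    qed
    then have "((\<lambda>t. V d (\<Phi> t x)) has_vector_derivative
        (\<Sum>b\<in>B. (c b (\<Phi> d x) - c b (\<Phi> 0 x)) *\<^sub>R b)) (at 0)"
      unfolding V_def has_real_derivative_iff_has_vector_derivative
      by (intro has_vector_derivative_sum
          bounded_linear.has_vector_derivative[OF bounded_linear_scaleR_left])
    then show ?thesis unfolding D_def by (auto simp: commute)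
  qed
  have lim: "((\<lambda>d. (1 / d) *\<^sub>R V d x) \<longlongrightarrow> x) (at 0 within {0..1})"
  proof -
    have "((\<lambda>d. integral {0..d} (\<lambda>s. c b (\<Phi> s x)) / d) \<longlongrightarrow> c b x) (at 0 within {0..1})"
      if b: "b \<in> B" for b
      using integral_has_real_derivative[OF cont[OF b], of 0 0 1 x] flow(2)
      by (simp add: has_field_derivative_iff)
    then have "((\<lambda>d. \<Sum>b\<in>B. (integral {0..d} (\<lambda>s. c b (\<Phi> s x)) / d) *\<^sub>R b)
        \<longlongrightarrow> (\<Sum>b\<in>B. c b x *\<^sub>R b)) (at 0 within {0..1})"
      by (intro tendsto_intros)
    then show ?thesis using rep by (simp add: V_def scaleR_sum_right)
  qed
  have "x \<in> D"
  proof (rule Lim_in_closed_set[OF closed _ _ lim])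
    show "\<forall>\<^sub>F d in at 0 within {0..1}. (1 / d) *\<^sub>R V d x \<in> D"
      unfolding eventually_at_filter
      by (intro always_eventually) (simp add: in_D subspace_scale[OF \<open>subspace D\<close>])
    show "at (0::real) within {0..1} \<noteq> bot"
      by (simp add: at_within_Icc_at_right trivial_limit_at_right_real)
  qed
  then show ?thesis by (simp add: D_def)
qed

lemma linear_flow_has_generator:
  fixes \<Phi> :: "real \<Rightarrow> 'a::real_normed_vector \<Rightarrow> 'a"
  assumes fd: "finite_dim TYPE('a)" and \<Phi>: "linear_flow \<Phi>"
  obtains A where "linear A" "\<forall>t x. ((\<lambda>t. \<Phi> t x) has_vector_derivative A (\<Phi> t x)) (at t)"
proof -
  note flow = linear_flowD[OF \<Phi>]
  obtain A where A: "\<And>x. ((\<lambda>t. \<Phi> t x) has_vector_derivative A x) (at 0)"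
    using linear_flow_differentiable_at_0[OF assms] by metis
  have "linear A"
  proof (rule linearI)
    fix x y :: 'a and r :: real
    have "((\<lambda>t. \<Phi> t (x + y)) has_vector_derivative A x + A y) (at 0)"
      using has_vector_derivative_add[OF A A] by (simp add: linear_add[OF flow(3)])
    then show "A (x + y) = A x + A y" using vector_derivative_unique_at[OF A] by blast
    have "((\<lambda>t. \<Phi> t (r *\<^sub>R x)) has_vector_derivative r *\<^sub>R A x) (at 0)"
      using bounded_linear.has_vector_derivative[OF bounded_linear_scaleR_right A, of r]
      by (simp add: linear_scale[OF flow(3)])
    then show "A (r *\<^sub>R x) = r *\<^sub>R A x" using vector_derivative_unique_at[OF A] by blast
  qed
  moreover have "\<forall>t x. ((\<lambda>t. \<Phi> t x) has_vector_derivative A (\<Phi> t x)) (at t)"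
  proof (intro allI)
    fix t x
    have "((\<lambda>s. s - t) has_vector_derivative 1) (at t)" by (auto intro!: derivative_eq_intros)
    from vector_diff_chain_at[OF this, of "\<lambda>s. \<Phi> s (\<Phi> t x)" "A (\<Phi> t x)"]
    show "((\<lambda>t. \<Phi> t x) has_vector_derivative A (\<Phi> t x)) (at t)"
      using A[of "\<Phi> t x"] by (simp add: o_def flow(1))
  qed
  ultimately show thesis by (rule that)
qed

lemma norm_funpow_le:
  fixes A :: "'a::real_normed_vector \<Rightarrow> 'a"
  assumes "\<And>x. norm (A x) \<le> K * norm x" "K \<ge> 0"
  shows "norm ((A ^^ n) x) \<le> K ^ n * norm x"
proof (induction n)
  case (Suc n)
  have "norm ((A ^^ Suc n) x) \<le> K * norm ((A ^^ n) x)" using assms(1) by simp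
  also have "\<dots> \<le> K * (K ^ n * norm x)" using Suc assms(2) by (rule mult_left_mono)
  finally show ?case by (simp add: mult.assoc)
qed simp

lemma linear_funpow:
  fixes A :: "'a::real_vector \<Rightarrow> 'a"
  shows "linear A \<Longrightarrow> linear (A ^^ n)"
  by (induction n) (auto intro: linear_compose module_hom_id simp: funpow.simps)

text \<open>Each coordinate of the trajectory is a smooth real function whose \<open>n\<close>-th derivative is a coordinate of
  \<open>(A ^^ n) (\<Phi> s x)\<close>. On the compact interval up to \<open>t\<close> this is at most a constant times \<open>K ^ n\<close>, so the
  Lagrange remainder tends to zero like the terms of an exponential series.\<close>

lemma linear_flow_sums:
  fixes \<Phi> :: "real \<Rightarrow> 'a::real_normed_vector \<Rightarrow> 'a"
  assumes fd: "finite_dim TYPE('a)" and \<Phi>: "linear_flow \<Phi>" and A: "linear A"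
    and der: "\<And>t x. ((\<lambda>t. \<Phi> t x) has_vector_derivative A (\<Phi> t x)) (at t)"
  shows "(\<lambda>n. (t ^ n / fact n) *\<^sub>R (A ^^ n) x) sums \<Phi> t x"
proof -
  note flow = linear_flowD[OF \<Phi>]
  obtain B :: "'a set" and c where B: "finite B" "\<forall>b\<in>B. bounded_linear (c b)"
    and rep: "\<forall>x. (\<Sum>b\<in>B. c b x *\<^sub>R b) = x"
    using finite_dim_coordinates[OF fd] .
  obtain K where K: "K > 0" "\<And>x. norm (A x) \<le> K * norm x"
    using bounded_linear.pos_bounded[OF finite_dim_linear_bounded[OF fd A]]
    by (auto simp: mult.commute)
  have "compact ((\<lambda>s. \<Phi> s x) ` {- \<bar>t\<bar>..\<bar>t\<bar>})"
    by (intro compact_continuous_image continuous_on_subset[OF flow(4)]) auto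
  then obtain M where M: "\<And>s. \<bar>s\<bar> \<le> \<bar>t\<bar> \<Longrightarrow> norm (\<Phi> s x) \<le> M"
    by (force dest!: compact_imp_bounded simp: bounded_iff abs_le_iff)
  have coord: "(\<lambda>n. (t ^ n / fact n) * c b ((A ^^ n) x)) sums c b (\<Phi> t x)" if b: "b \<in> B" for b
  proof -
    have cb: "bounded_linear (c b)" using B(2) b by blast
    obtain L where L: "L > 0" "\<And>x. norm (c b x) \<le> L * norm x"
      using bounded_linear.pos_bounded[OF cb] by (auto simp: mult.commute)
    define f where "f n s = c b ((A ^^ n) (\<Phi> s x))" for n s
    have f_der: "(f n has_real_derivative f (Suc n) s) (at s)" for n s
    proof -
      have "bounded_linear (\<lambda>y. c b ((A ^^ n) y))"
        by (rule bounded_linear_compose[OF cb finite_dim_linear_bounded[OF fd linear_funpow[OF A]]])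
      from bounded_linear.has_vector_derivative[OF this der[of x s]]
      show ?thesis
        unfolding f_def has_real_derivative_iff_has_vector_derivative
        by (simp add: funpow_swap1)
    qed
    have bound: "norm (c b (\<Phi> t x) - (\<Sum>m<n. (t ^ m / fact m) * c b ((A ^^ m) x)))
        \<le> L * M * (inverse (fact n) * (K * \<bar>t\<bar>) ^ n)" for n
    proof -
      obtain s where s: "\<bar>s\<bar> \<le> \<bar>t\<bar>"
        "f 0 t = (\<Sum>m<n. (f m 0 / fact m) * t ^ m) + (f n s / fact n) * t ^ n"
        using Maclaurin_all_le[of f "f 0" t n] f_der by blast
      have "c b (\<Phi> t x) - (\<Sum>m<n. (t ^ m / fact m) * c b ((A ^^ m) x)) = (f n s / fact n) * t ^ n"
        using s(2) by (simp add: f_def flow(2) mult.commute)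
      moreover have "norm (f n s) \<le> L * (K ^ n * M)"
      proof -
        have "norm (f n s) \<le> L * norm ((A ^^ n) (\<Phi> s x))" using L(2) by (simp add: f_def)
        also have "\<dots> \<le> L * (K ^ n * norm (\<Phi> s x))"
          using norm_funpow_le[of A K] K L(1) by (intro mult_left_mono) auto
        also have "\<dots> \<le> L * (K ^ n * M)"
          using M[OF s(1)] K(1) L(1) by (intro mult_left_mono) auto
        finally show ?thesis .
      qed
      then have "norm (f n s) * (\<bar>t\<bar> ^ n / fact n) \<le> L * (K ^ n * M) * (\<bar>t\<bar> ^ n / fact n)"
        by (rule mult_right_mono) simp
      ultimately show ?thesis
        by (simp add: abs_mult power_abs power_mult_distrib divide_inverse mult_ac)
    qed
    have "(\<lambda>n. L * M * (inverse (fact n) * (K * \<bar>t\<bar>) ^ n)) \<longlonglongrightarrow> 0"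
      using tendsto_mult_left[OF summable_LIMSEQ_zero[OF summable_exp], of "L * M"] by simp
    then have "(\<lambda>n. c b (\<Phi> t x) - (\<Sum>m<n. (t ^ m / fact m) * c b ((A ^^ m) x))) \<longlonglongrightarrow> 0"
      by (rule Lim_null_comparison[rotated]) (intro always_eventually allI bound)
    then have "(\<lambda>n. c b (\<Phi> t x) - (c b (\<Phi> t x) - (\<Sum>m<n. (t ^ m / fact m) * c b ((A ^^ m) x))))
        \<longlonglongrightarrow> c b (\<Phi> t x) - 0"
      by (intro tendsto_diff tendsto_const)
    then show ?thesis by (simp add: sums_def)
  qed
  have "(\<lambda>n. \<Sum>b\<in>B. ((t ^ n / fact n) * c b ((A ^^ n) x)) *\<^sub>R b) sums (\<Sum>b\<in>B. c b (\<Phi> t x) *\<^sub>R b)"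
    by (intro sums_sum bounded_linear.sums[OF bounded_linear_scaleR_left] coord)
  moreover have "(\<Sum>b\<in>B. ((t ^ n / fact n) * c b ((A ^^ n) x)) *\<^sub>R b) = (t ^ n / fact n) *\<^sub>R (A ^^ n) x" for n
  proof -
    have "(\<Sum>b\<in>B. ((t ^ n / fact n) * c b ((A ^^ n) x)) *\<^sub>R b)
        = (t ^ n / fact n) *\<^sub>R (\<Sum>b\<in>B. c b ((A ^^ n) x) *\<^sub>R b)"
      by (simp only: scaleR_sum_right scaleR_scaleR)
    then show ?thesis by (simp only: rep)
  qed
  ultimately show ?thesis by (simp only: rep)
qed

lemma op_exp_scaleR:
  assumes "linear A"
  shows "op_exp (\<lambda>x. t *\<^sub>R A x) x = (\<Sum>n. (t ^ n / fact n) *\<^sub>R (A ^^ n) x)"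
proof -
  have "((\<lambda>x. t *\<^sub>R A x) ^^ n) x = t ^ n *\<^sub>R (A ^^ n) x" for n
    by (induction n) (simp_all add: linear_scale[OF assms])
  then show ?thesis by (simp add: op_exp_def divide_inverse mult.commute)
qed

text \<open>This makes the generator unique: it can be read off from the flow as the derivative at time zero. In each
  coordinate the exponential series is a real power series in \<open>t\<close>, whose derivative at zero is its
  first coefficient.\<close>

lemma op_exp_has_derivative_at_0:
  fixes A :: "'a::real_normed_vector \<Rightarrow> 'a"
  assumes fd: "finite_dim TYPE('a)" and A: "linear A"
  shows "((\<lambda>t. op_exp (\<lambda>x. t *\<^sub>R A x) x) has_vector_derivative A x) (at 0)"
proof -
  obtain B :: "'a set" and c where B: "finite B" "\<forall>b\<in>B. bounded_linear (c b)"
    and rep: "\<forall>x. (\<Sum>b\<in>B. c b x *\<^sub>R b) = x"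
    using finite_dim_coordinates[OF fd] .
  obtain K where K: "K > 0" "\<And>x. norm (A x) \<le> K * norm x"
    using bounded_linear.pos_bounded[OF finite_dim_linear_bounded[OF fd A]]
    by (auto simp: mult.commute)
  define d where "d b n = c b ((A ^^ n) x) / fact n" for b n
  have summ: "summable (\<lambda>n. d b n * t ^ n)" if b: "b \<in> B" for b t
  proof -
    have cb: "bounded_linear (c b)" using B(2) b by blast
    obtain L where L: "L > 0" "\<And>x. norm (c b x) \<le> L * norm x"
      using bounded_linear.pos_bounded[OF cb] by (auto simp: mult.commute)
    have "norm (d b n * t ^ n) \<le> L * norm x * (inverse (fact n) * (K * \<bar>t\<bar>) ^ n)" for n
    proof -
      have "norm (c b ((A ^^ n) x)) \<le> L * norm ((A ^^ n) x)" by (rule L(2))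
      also have "\<dots> \<le> L * (K ^ n * norm x)"
        using norm_funpow_le[of A K] K L(1) by (intro mult_left_mono) auto
      finally have "norm (c b ((A ^^ n) x)) * (\<bar>t\<bar> ^ n / fact n) \<le> L * (K ^ n * norm x) * (\<bar>t\<bar> ^ n / fact n)"
        by (rule mult_right_mono) simp
      then show ?thesis
        by (simp add: d_def abs_mult power_abs power_mult_distrib divide_inverse mult_ac)
    qed
    then show ?thesis
      by (intro summable_comparison_test'[OF summable_mult[OF summable_exp]])
  qed
  have "op_exp (\<lambda>x. t *\<^sub>R A x) x = (\<Sum>b\<in>B. (\<Sum>n. d b n * t ^ n) *\<^sub>R b)" for t
  proof -
    have "(\<lambda>n. \<Sum>b\<in>B. (d b n * t ^ n) *\<^sub>R b) sums (\<Sum>b\<in>B. (\<Sum>n. d b n * t ^ n) *\<^sub>R b)"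
      by (intro sums_sum bounded_linear.sums[OF bounded_linear_scaleR_left] summable_sums summ)
    moreover have "(\<Sum>b\<in>B. (d b n * t ^ n) *\<^sub>R b) = (t ^ n / fact n) *\<^sub>R (A ^^ n) x" for n
    proof -
      have "(\<Sum>b\<in>B. (d b n * t ^ n) *\<^sub>R b)
          = (t ^ n / fact n) *\<^sub>R (\<Sum>b\<in>B. c b ((A ^^ n) x) *\<^sub>R b)"
        by (simp add: scaleR_sum_right d_def mult.commute)
      then show ?thesis by (simp only: rep)
    qed
    ultimately have "(\<lambda>n. (t ^ n / fact n) *\<^sub>R (A ^^ n) x) sums (\<Sum>b\<in>B. (\<Sum>n. d b n * t ^ n) *\<^sub>R b)"
      by (simp only:)
    then show ?thesis unfolding op_exp_scaleR[OF A] by (rule sums_unique[symmetric])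
  qed
  moreover have "((\<lambda>t. \<Sum>b\<in>B. (\<Sum>n. d b n * t ^ n) *\<^sub>R b) has_vector_derivative
      (\<Sum>b\<in>B. c b (A x) *\<^sub>R b)) (at 0)"
  proof (intro has_vector_derivative_sum bounded_linear.has_vector_derivative[OF bounded_linear_scaleR_left])
    fix b assume b: "b \<in> B"
    have "((\<lambda>t. \<Sum>n. d b n * t ^ n) has_real_derivative (\<Sum>n. diffs (d b) n * 0 ^ n)) (at 0)"
      by (rule termdiffs_strong_converges_everywhere) (rule summ[OF b])
    moreover have "(\<Sum>n. diffs (d b) n * 0 ^ n) = c b (A x)"
      unfolding powser_zero by (simp add: diffs_def d_def)
    ultimately show "((\<lambda>t. \<Sum>n. d b n * t ^ n) has_vector_derivative c b (A x)) (at 0)"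
      by (simp add: has_real_derivative_iff_has_vector_derivative)
  qed
  ultimately show ?thesis by (simp only: rep)
qed

lemma linear_flow_generator:
  fixes \<Phi> :: "real \<Rightarrow> 'a::real_normed_vector \<Rightarrow> 'a"
  assumes fd: "finite_dim TYPE('a)" and \<Phi>: "linear_flow \<Phi>"
  shows linear_generator: "linear (generator \<Phi>)"
    and generator_derivative:
      "((\<lambda>t. \<Phi> t x) has_vector_derivative generator \<Phi> (\<Phi> t x)) (at t)"
    and generator_sums: "(\<lambda>n. (t ^ n / fact n) *\<^sub>R (generator \<Phi> ^^ n) x) sums \<Phi> t x"
proof -
  obtain A where A: "linear A"
    and der': "\<forall>t x. ((\<lambda>t. \<Phi> t x) has_vector_derivative A (\<Phi> t x)) (at t)"
    using linear_flow_has_generator[OF assms] .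
  note der = der'[rule_format]
  note sums = linear_flow_sums[OF fd \<Phi> A der]
  have "generator \<Phi> = A"
    unfolding generator_def
  proof (rule the_equality)
    show "linear A \<and> (\<forall>t. \<Phi> t = op_exp (\<lambda>x. t *\<^sub>R A x))"
      using A by (auto simp: fun_eq_iff op_exp_scaleR sums_unique[OF sums])
    fix A' assume A': "linear A' \<and> (\<forall>t. \<Phi> t = op_exp (\<lambda>x. t *\<^sub>R A' x))"
    show "A' = A"
    proof
      fix x
      have "((\<lambda>t. \<Phi> t x) has_vector_derivative A' x) (at 0)"
        using op_exp_has_derivative_at_0[OF fd, of A' x] A' by simp
      moreover have "((\<lambda>t. \<Phi> t x) has_vector_derivative A x) (at 0)"
        using der[of x 0] by (simp add: linear_flowD(2)[OF \<Phi>])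
      ultimately show "A' x = A x" by (rule vector_derivative_unique_at)
    qed
  qed
  then show "linear (generator \<Phi>)"
    "((\<lambda>t. \<Phi> t x) has_vector_derivative generator \<Phi> (\<Phi> t x)) (at t)"
    "(\<lambda>n. (t ^ n / fact n) *\<^sub>R (generator \<Phi> ^^ n) x) sums \<Phi> t x"
    using A der sums by simp_all
qed

lemma generator_eq_0_iff_fixed:
  fixes \<Phi> :: "real \<Rightarrow> 'a::real_normed_vector \<Rightarrow> 'a"
  assumes fd: "finite_dim TYPE('a)" and \<Phi>: "linear_flow \<Phi>"
  shows "generator \<Phi> x = 0 \<longleftrightarrow> (\<forall>t. \<Phi> t x = x)"
proof
  assume 0: "generator \<Phi> x = 0"
  have "(generator \<Phi> ^^ n) x = 0" if "n \<noteq> 0" for n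
    using that 0 linear_0[OF linear_funpow[OF linear_generator[OF assms]]]
    by (cases n) (simp_all add: funpow_Suc_right del: funpow.simps)
  then have "(\<lambda>n. (t ^ n / fact n) *\<^sub>R (generator \<Phi> ^^ n) x) sums x" for t
    using sums_finite[of "{0}" "\<lambda>n. (t ^ n / fact n) *\<^sub>R (generator \<Phi> ^^ n) x"] by simp
  then show "\<forall>t. \<Phi> t x = x" using generator_sums[OF assms] sums_unique2 by blast
next
  assume fixed: "\<forall>t. \<Phi> t x = x"
  then have "((\<lambda>t. x) has_vector_derivative generator \<Phi> x) (at 0)"
    using generator_derivative[OF assms, of x 0] by simp
  then show "generator \<Phi> x = 0"
    using vector_derivative_unique_at has_vector_derivative_const by blast
qed

section \<open>Orbit equivalences\<close>

text \<open>The last two equations are the chain rule applied to \<open>inv h \<circ> h\<close> and \<open>h \<circ> inv h\<close>.\<close>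

lemma C1_diffeomorphism_derivatives:
  assumes "C1_diffeomorphism h"
  obtains h' k' where "\<forall>x. (h has_derivative blinfun_apply (h' x)) (at x)"
    and "continuous_on UNIV h'"
    and "\<forall>y. (inv h has_derivative blinfun_apply (k' y)) (at y)"
    and "\<forall>x v. k' (h x) (h' x v) = v" and "\<forall>x w. h' x (k' (h x) w) = w"
proof -
  have bij: "bij h" using assms by (simp add: C1_diffeomorphism_def)
  obtain h' where h': "\<forall>x. (h has_derivative blinfun_apply (h' x)) (at x)" "continuous_on UNIV h'"
    using assms unfolding C1_diffeomorphism_def C1_def by blast
  obtain k' where k': "\<forall>y. (inv h has_derivative blinfun_apply (k' y)) (at y)"
    using assms unfolding C1_diffeomorphism_def C1_def by blast
  have "blinfun_apply (k' (h x)) \<circ> blinfun_apply (h' x) = id" for x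
  proof (rule has_derivative_unique)
    show "(inv h \<circ> h has_derivative blinfun_apply (k' (h x)) \<circ> blinfun_apply (h' x)) (at x)"
      using h'(1) k' by (intro diff_chain_at) auto
    show "(inv h \<circ> h has_derivative id) (at x)"
      using bij by (simp add: bij_is_inj id_def)
  qed
  moreover have "blinfun_apply (h' x) \<circ> blinfun_apply (k' (h x)) = id" for x
  proof (rule has_derivative_unique)
    have "(h has_derivative blinfun_apply (h' x)) (at (inv h (h x)))"
      using h'(1) bij by (simp add: bij_is_inj)
    then show "(h \<circ> inv h has_derivative blinfun_apply (h' x) \<circ> blinfun_apply (k' (h x))) (at (h x))"
      using k' by (intro diff_chain_at) auto
    show "(h \<circ> inv h has_derivative id) (at (h x))"
      using bij by (simp add: bij_is_surj surj_iff[THEN iffD1] id_def[symmetric] has_derivative_id)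
  qed
  ultimately show thesis
    using h' k' by (intro that[of h' k']) (auto simp: fun_eq_iff)
qed

text \<open>If \<open>x\<close> is fixed, then every \<open>\<tau> t x\<close> is a period of \<open>h x\<close> under \<open>\<Psi>\<close>. Near a time where \<open>\<tau>\<close> is continuous these
  periods accumulate, so \<open>h x\<close> returns after arbitrarily short positive times and its velocity must
  vanish. The codirectional relation alone would not give this, as it holds for the zero vector.\<close>

lemma orbit_equivalence_fixed_points:
  fixes \<Phi> :: "real \<Rightarrow> 'a::real_normed_vector \<Rightarrow> 'a" and \<Psi> :: "real \<Rightarrow> 'b::real_normed_vector \<Rightarrow> 'b"
  assumes fd: "finite_dim TYPE('a)" "finite_dim TYPE('b)"
    and flows: "linear_flow \<Phi>" "linear_flow \<Psi>"
    and "inj h"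
    and \<tau>: "strict_mono (\<lambda>t. \<tau> t x)"
    and eq: "\<And>t. h (\<Phi> t x) = \<Psi> (\<tau> t x) (h x)"
  shows "generator \<Phi> x = 0 \<longleftrightarrow> generator \<Psi> (h x) = 0"
proof
  assume "generator \<Psi> (h x) = 0"
  then have "\<Psi> t (h x) = h x" for t
    using generator_eq_0_iff_fixed[OF fd(2) flows(2)] by blast
  then have "\<Phi> t x = x" for t using eq[of t] injD[OF \<open>inj h\<close>] by simp
  then show "generator \<Phi> x = 0"
    using generator_eq_0_iff_fixed[OF fd(1) flows(1)] by blast
next
  assume "generator \<Phi> x = 0"
  then have "\<Phi> t x = x" for t
    using generator_eq_0_iff_fixed[OF fd(1) flows(1)] by blast
  then have fixed: "\<Psi> (\<tau> t x) (h x) = h x" for t using eq[of t] by simp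
  obtain t0 where t0: "isCont (\<lambda>t. \<tau> t x) t0"
    using open_minus_countable[OF mono_ctble_discont[OF strict_mono_mono[OF \<tau>]], of UNIV] by auto
  have "((\<lambda>t. \<Psi> t (h x)) has_vector_derivative generator \<Psi> (h x)) (at (\<tau> t0 x))"
    using generator_derivative[OF fd(2) flows(2), of "h x" "\<tau> t0 x"] by (simp add: fixed)
  from quotient_along_reparametrization[OF this \<tau> t0]
  have "((\<lambda>t. 0) \<longlongrightarrow> generator \<Psi> (h x)) (at t0)" by (simp add: fixed)
  then show "generator \<Psi> (h x) = 0"
    using tendsto_unique[OF at_neq_bot _ tendsto_const] by blast
qed

text \<open>The two curves have the velocities \<open>h' (\<Phi> t x) (A (\<Phi> t x))\<close> and \<open>B (h (\<Phi> t x))\<close>, both continuous in \<open>t\<close>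
  whatever \<open>\<tau>\<close> does; the claim is the case \<open>t = 0\<close>. There \<open>\<tau> 0 x\<close> may be different from zero, but it
  is a period of \<open>h x\<close>.\<close>

lemma orbit_equivalence_codirectional:
  fixes \<Phi> :: "real \<Rightarrow> 'a::real_normed_vector \<Rightarrow> 'a" and \<Psi> :: "real \<Rightarrow> 'b::real_normed_vector \<Rightarrow> 'b"
  assumes fd: "finite_dim TYPE('a)" "finite_dim TYPE('b)"
    and flows: "linear_flow \<Phi>" "linear_flow \<Psi>"
    and h': "\<And>x. (h has_derivative blinfun_apply (h' x)) (at x)" "continuous_on UNIV h'"
    and \<tau>: "strict_mono (\<lambda>t. \<tau> t x)"
    and eq: "\<And>t. h (\<Phi> t x) = \<Psi> (\<tau> t x) (h x)"
  shows "codirectional (h' x (generator \<Phi> x)) (generator \<Psi> (h x))"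
proof -
  note A = finite_dim_linear_bounded[OF fd(1) linear_generator[OF fd(1) flows(1)]]
  note B = finite_dim_linear_bounded[OF fd(2) linear_generator[OF fd(2) flows(2)]]
  note \<Phi>_cont = linear_flowD(4)[OF flows(1), of x]
  have h_cont: "continuous_on UNIV h"
    by (auto simp: continuous_on_eq_continuous_at intro: has_derivative_continuous[OF h'(1)])
  have "codirectional (h' (\<Phi> 0 x) (generator \<Phi> (\<Phi> 0 x))) (generator \<Psi> (\<Psi> (\<tau> 0 x) (h x)))"
  proof (rule codirectional_monotone_reparametrization[where c = "\<lambda>t. h (\<Phi> t x)"
        and c' = "\<lambda>t. h' (\<Phi> t x) (generator \<Phi> (\<Phi> t x))" and \<gamma> = "\<lambda>s. \<Psi> s (h x)"
        and \<gamma>' = "\<lambda>s. generator \<Psi> (\<Psi> s (h x))" and s = "\<lambda>t. \<tau> t x"])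
    fix t
    show "((\<lambda>t. h (\<Phi> t x)) has_vector_derivative h' (\<Phi> t x) (generator \<Phi> (\<Phi> t x))) (at t)"
      using vector_derivative_diff_chain_within[OF generator_derivative[OF fd(1) flows(1), of x t]
          has_derivative_at_withinI[OF h'(1)]] by (simp add: o_def)
    show "((\<lambda>s. \<Psi> s (h x)) has_vector_derivative generator \<Psi> (\<Psi> t (h x))) (at t)"
      by (rule generator_derivative[OF fd(2) flows(2)])
    show "h (\<Phi> t x) = \<Psi> (\<tau> t x) (h x)" by (rule eq)
  next
    show "strict_mono (\<lambda>t. \<tau> t x)" by (rule \<tau>)
    show "continuous_on UNIV (\<lambda>t. h' (\<Phi> t x) (generator \<Phi> (\<Phi> t x)))"
      by (intro blinfun.continuous_on continuous_on_compose2[OF h'(2) \<Phi>_cont]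
          bounded_linear.continuous_on[OF A] \<Phi>_cont) simp
    show "continuous_on UNIV (\<lambda>t. generator \<Psi> (\<Psi> (\<tau> t x) (h x)))"
      unfolding eq[symmetric]
      by (intro bounded_linear.continuous_on[OF B] continuous_on_compose2[OF h_cont \<Phi>_cont]) simp
  qed
  then show ?thesis
    by (simp add: eq[symmetric] linear_flowD(2)[OF flows(1)])
qed

lemma derivative_along_line:
  assumes "(f has_derivative f') (at p)"
  shows "((\<lambda>r::real. f (p + r *\<^sub>R v)) has_vector_derivative f' v) (at 0)"
proof -
  have "((\<lambda>r::real. p + r *\<^sub>R v) has_vector_derivative v) (at 0)"
    by (auto intro!: derivative_eq_intros)
  from vector_derivative_diff_chain_within[OF this, of f f'] show ?thesis
    using assms by (simp add: o_def has_derivative_at_withinI)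
qed

text \<open>The codirectional relation and the fixed points are linearized at the origin. The point \<open>h 0\<close> may be
  different from zero, but it is fixed by \<open>\<Psi>\<close>, so it lies in the kernel of the generator of \<open>\<Psi>\<close>,
  which therefore does not see the translation by \<open>h 0\<close>.\<close>

lemma orbit_equivalent_imp_similar:
  fixes \<Phi> :: "real \<Rightarrow> 'a::real_normed_vector \<Rightarrow> 'a" and \<Psi> :: "real \<Rightarrow> 'b::real_normed_vector \<Rightarrow> 'b"
  assumes fd: "finite_dim TYPE('a)" "finite_dim TYPE('b)"
    and flows: "linear_flow \<Phi>" "linear_flow \<Psi>"
    and equiv: "C1_orbit_equivalent \<Phi> \<Psi>"
  shows "\<exists>\<alpha>>0. similar_ops (generator \<Phi>) (\<lambda>y. \<alpha> *\<^sub>R generator \<Psi> y)"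
proof -
  let ?A = "generator \<Phi>" and ?B = "generator \<Psi>"
  obtain h \<tau> where diffeo: "C1_diffeomorphism h" and \<tau>: "\<And>x. strict_mono (\<lambda>t. \<tau> t x)"
    and eq: "\<And>t x. h (\<Phi> t x) = \<Psi> (\<tau> t x) (h x)"
    using equiv unfolding C1_orbit_equivalent_def by blast
  obtain h' k' where h': "\<forall>x. (h has_derivative blinfun_apply (h' x)) (at x)" "continuous_on UNIV h'"
    and k': "\<forall>y. (inv h has_derivative blinfun_apply (k' y)) (at y)"
    and inverse: "\<forall>x v. k' (h x) (h' x v) = v" "\<forall>x w. h' x (k' (h x) w) = w"
    using C1_diffeomorphism_derivatives[OF diffeo] .
  have bij: "bij h" using diffeo by (simp add: C1_diffeomorphism_def)
  note A = linear_generator[OF fd(1) flows(1)] and B = linear_generator[OF fd(2) flows(2)]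
  note A_bl = finite_dim_linear_bounded[OF fd(1) A] and B_bl = finite_dim_linear_bounded[OF fd(2) B]
  have fixed: "?A x = 0 \<longleftrightarrow> ?B (h x) = 0" for x
    by (rule orbit_equivalence_fixed_points[OF fd flows bij_is_inj[OF bij] \<tau> eq])
  have B0: "?B (h 0) = 0" using fixed[of 0] linear_0[OF A] by simp
  define H where "H = blinfun_apply (h' 0)"
  have H: "linear H" by (simp add: H_def blinfun.bounded_linear_right bounded_linear.linear)
  have H_iso: "linear_isomorphism H"
    unfolding linear_isomorphism_def
  proof
    show "bij H"
      using inverse by (intro bij_betw_byWitness[where f' = "blinfun_apply (k' (h 0))"])
        (auto simp: H_def)
  qed (rule H)
  have B_line: "((\<lambda>r. ?B (h (r *\<^sub>R x))) has_vector_derivative ?B (H x)) (at 0)" for x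
    using bounded_linear.has_vector_derivative[OF B_bl derivative_along_line[OF h'(1)[rule_format, of 0], of x]]
    by (simp add: H_def)
  \<comment> \<open>Zoom in on the origin along the ray through \<open>x\<close>.\<close>
  have "codirectional (H (?A x)) (?B (H x))" for x
  proof (rule codirectional_tendsto)
    show "at_right (0::real) \<noteq> bot" by (rule trivial_limit_at_right_real)
    have "isCont h' 0" using h'(2) by (simp add: continuous_on_eq_continuous_at)
    then have "((\<lambda>r. h' (r *\<^sub>R x)) \<longlongrightarrow> h' 0) (at_right (0::real))"
      by (rule isCont_tendsto_compose) (auto intro!: tendsto_eq_intros)
    then show "((\<lambda>r. h' (r *\<^sub>R x) (?A x)) \<longlongrightarrow> H (?A x)) (at_right 0)"
      unfolding H_def by (intro blinfun.tendsto tendsto_const)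
    show "((\<lambda>r. (1 / r) *\<^sub>R ?B (h (r *\<^sub>R x))) \<longlongrightarrow> ?B (H x)) (at_right 0)"
      using has_vector_derivative_at_within[OF B_line[of x], of "{0<..}"]
      by (simp add: has_vector_derivative_at_iff_quotient B0)
    have "codirectional (h' (r *\<^sub>R x) (?A x)) ((1 / r) *\<^sub>R ?B (h (r *\<^sub>R x)))" if "r > 0" for r
    proof -
      have "codirectional (r *\<^sub>R h' (r *\<^sub>R x) (?A x)) (?B (h (r *\<^sub>R x)))"
        using orbit_equivalence_codirectional[OF fd flows h'(1)[rule_format] h'(2) \<tau> eq, where x = "r *\<^sub>R x"]
        by (simp add: linear_scale[OF A] blinfun.scaleR_right)
      then show ?thesis
        using codirectional_scaleR[of "1 / r" "1 / r" "r *\<^sub>R h' (r *\<^sub>R x) (?A x)"] that by simp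
    qed
    then show "\<forall>\<^sub>F r in at_right 0. codirectional (h' (r *\<^sub>R x) (?A x)) ((1 / r) *\<^sub>R ?B (h (r *\<^sub>R x)))"
      by (simp add: eventually_at_filter)
  qed
  \<comment> \<open>Both kernels are linear: \<open>h\<close> maps the line through a fixed point \<open>x\<close> into the kernel of \<open>B\<close>, so its
    tangent vector \<open>H x\<close> lies there too, and \<open>inv h\<close> does the same for a line in the kernel of \<open>B\<close>
    that is translated to \<open>h 0\<close>.\<close>
  moreover have "H (?A x) = 0 \<longleftrightarrow> ?B (H x) = 0" for x
  proof
    assume "H (?A x) = 0"
    then have "?A x = 0" using inverse(1) blinfun.zero_right unfolding H_def by metis
    then have "?B (h (r *\<^sub>R x)) = 0" for r
      using fixed[where x = "r *\<^sub>R x"] by (simp add: linear_scale[OF A])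
    then have "((\<lambda>r::real. 0) has_vector_derivative ?B (H x)) (at 0)" using B_line[of x] by simp
    then show "?B (H x) = 0" using vector_derivative_unique_at has_vector_derivative_const by blast
  next
    assume BH: "?B (H x) = 0"
    have "?A (inv h (h 0 + r *\<^sub>R H x)) = 0" for r
      using fixed[of "inv h (h 0 + r *\<^sub>R H x)"] BH B0 bij
      by (simp add: bij_is_surj surj_f_inv_f linear_add[OF B] linear_scale[OF B])
    moreover have "((\<lambda>r. ?A (inv h (h 0 + r *\<^sub>R H x))) has_vector_derivative ?A (k' (h 0) (H x))) (at 0)"
      using bounded_linear.has_vector_derivative[OF A_bl derivative_along_line[OF k'[rule_format]]] .
    ultimately have "((\<lambda>r::real. 0) has_vector_derivative ?A x) (at 0)"
      using inverse(1) by (simp add: H_def)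
    then have "?A x = 0" using vector_derivative_unique_at has_vector_derivative_const by blast
    then show "H (?A x) = 0" by (simp add: linear_0[OF H])
  qed
  ultimately obtain \<alpha> where "\<alpha> > 0" "\<And>x. H (?A x) = \<alpha> *\<^sub>R ?B (H x)"
    using codirectional_linear_maps_proportional[of "\<lambda>x. H (?A x)" "\<lambda>x. ?B (H x)"]
      linear_compose[OF A H] linear_compose[OF H B] by (auto simp: o_def)
  then show ?thesis
    using H_iso unfolding similar_ops_def by (auto simp: fun_eq_iff)
qed

lemma bounded_linear_imp_C1:
  assumes "bounded_linear f"
  shows "C1 f"
  unfolding C1_def
  using bounded_linear_imp_has_derivative[OF assms]
  by (intro exI[of _ "\<lambda>_. Blinfun f"]) (simp add: bounded_linear_Blinfun_apply[OF assms])

lemma linear_isomorphism_imp_C1_diffeomorphism: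
  fixes h :: "'a::real_normed_vector \<Rightarrow> 'b::real_normed_vector"
  assumes fd: "finite_dim TYPE('a)" "finite_dim TYPE('b)" and h: "linear_isomorphism h"
  shows "C1_diffeomorphism h"
proof -
  have bij: "bij h" and lin: "linear h" using h by (auto simp: linear_isomorphism_def)
  have "linear (inv h)"
  proof (rule linearI)
    fix x y and r :: real
    show "inv h (x + y) = inv h x + inv h y"
      by (rule inv_f_eq[OF bij_is_inj[OF bij]])
        (simp add: linear_add[OF lin] surj_f_inv_f[OF bij_is_surj[OF bij]])
    show "inv h (r *\<^sub>R x) = r *\<^sub>R inv h x"
      by (rule inv_f_eq[OF bij_is_inj[OF bij]])
        (simp add: linear_scale[OF lin] surj_f_inv_f[OF bij_is_surj[OF bij]])
  qed
  then show ?thesis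
    unfolding C1_diffeomorphism_def
    by (intro conjI bij bounded_linear_imp_C1 finite_dim_linear_bounded fd lin)
qed

lemma linearly_flow_equivalent_imp_C1_flow_equivalent:
  fixes \<Phi> :: "real \<Rightarrow> 'a::real_normed_vector \<Rightarrow> 'a" and \<Psi> :: "real \<Rightarrow> 'b::real_normed_vector \<Rightarrow> 'b"
  assumes "finite_dim TYPE('a)" "finite_dim TYPE('b)" "linearly_flow_equivalent \<Phi> \<Psi>"
  shows "C1_flow_equivalent \<Phi> \<Psi>"
  using assms linear_isomorphism_imp_C1_diffeomorphism
  unfolding linearly_flow_equivalent_def C1_flow_equivalent_def by metis

lemma C1_flow_equivalent_imp_C1_orbit_equivalent:
  assumes "C1_flow_equivalent \<Phi> \<Psi>"
  shows "C1_orbit_equivalent \<Phi> \<Psi>"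
proof -
  obtain h and \<alpha> :: real where "C1_diffeomorphism h" "\<alpha> > 0" "\<forall>t x. h (\<Phi> t x) = \<Psi> (\<alpha> * t) (h x)"
    using assms unfolding C1_flow_equivalent_def by blast
  then show ?thesis
    unfolding C1_orbit_equivalent_def
    by (intro exI[of _ h] exI[of _ "\<lambda>t x. \<alpha> * t"]) (simp add: strict_mono_def)
qed

lemma similar_imp_linearly_flow_equivalent:
  fixes \<Phi> :: "real \<Rightarrow> 'a::real_normed_vector \<Rightarrow> 'a" and \<Psi> :: "real \<Rightarrow> 'b::real_normed_vector \<Rightarrow> 'b"
  assumes fd: "finite_dim TYPE('a)" "finite_dim TYPE('b)"
    and flows: "linear_flow \<Phi>" "linear_flow \<Psi>"
    and "\<alpha> > 0" "similar_ops (generator \<Phi>) (\<lambda>y. \<alpha> *\<^sub>R generator \<Psi> y)"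
  shows "linearly_flow_equivalent \<Phi> \<Psi>"
proof -
  let ?A = "generator \<Phi>" and ?B = "generator \<Psi>"
  obtain H where H: "linear_isomorphism H" and HA: "\<And>x. H (?A x) = \<alpha> *\<^sub>R ?B (H x)"
    using assms(6) unfolding similar_ops_def by (auto simp: fun_eq_iff)
  have lin: "linear H" using H by (simp add: linear_isomorphism_def)
  have pow: "H ((?A ^^ n) x) = \<alpha> ^ n *\<^sub>R (?B ^^ n) (H x)" for n x
    by (induction n) (simp_all add: HA linear_scale[OF linear_generator[OF fd(2) flows(2)]])
  have "H (\<Phi> t x) = \<Psi> (\<alpha> * t) (H x)" for t x
  proof (rule sums_unique2)
    show "(\<lambda>n. ((\<alpha> * t) ^ n / fact n) *\<^sub>R (?B ^^ n) (H x)) sums \<Psi> (\<alpha> * t) (H x)"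
      by (rule generator_sums[OF fd(2) flows(2)])
    show "(\<lambda>n. ((\<alpha> * t) ^ n / fact n) *\<^sub>R (?B ^^ n) (H x)) sums H (\<Phi> t x)"
      using bounded_linear.sums[OF finite_dim_linear_bounded[OF fd(1) lin]
          generator_sums[OF fd(1) flows(1), of t x]]
      by (simp add: linear_scale[OF lin] pow power_mult_distrib mult.commute)
  qed
  then show ?thesis
    unfolding linearly_flow_equivalent_def using H \<open>\<alpha> > 0\<close> by blast
qed

theorem theorem1p2:
  fixes \<Phi> :: "real \<Rightarrow> 'a::real_normed_vector \<Rightarrow> 'a"
    and \<Psi> :: "real \<Rightarrow> 'b::real_normed_vector \<Rightarrow> 'b"
  assumes "finite_dim TYPE('a)" and "finite_dim TYPE('b)"
    and "linear_flow \<Phi>" and "linear_flow \<Psi>"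
  shows "(C1_orbit_equivalent \<Phi> \<Psi> \<longleftrightarrow> C1_flow_equivalent \<Phi> \<Psi>) \<and>
         (C1_flow_equivalent \<Phi> \<Psi> \<longleftrightarrow> linearly_flow_equivalent \<Phi> \<Psi>) \<and>
         (linearly_flow_equivalent \<Phi> \<Psi> \<longleftrightarrow>
            (\<exists>\<alpha>::real. \<alpha> > 0 \<and> similar_ops (generator \<Phi>) (\<lambda>y. \<alpha> *\<^sub>R generator \<Psi> y)))"
  using orbit_equivalent_imp_similar[OF assms] similar_imp_linearly_flow_equivalent[OF assms]
    linearly_flow_equivalent_imp_C1_flow_equivalent[OF assms(1,2), of \<Phi> \<Psi>]
    C1_flow_equivalent_imp_C1_orbit_equivalent[of \<Phi> \<Psi>]
  by blast

end
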